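(* Let $\lambda=(\lambda_1,\dots,\lambda_k)$ be a pseudo-partition and let $s=(s_1,\dots,s_k)$ be a strictly increasing sequence of elements of $\{1,\dots,n\}$. Then $$\sum_{T\in\mathrm{SST}(\lambda,s)}\mathrm{wt}(T)=\Big(\prod_{i=1}^k x_{s_i}\Big)\det\Big(h_{\lambda_j-j+i-1}(x_1,x_2,\dots,x_{s_j})\Big)_{i,j\in\{1,\dots,k\}}.$$
   Context: A pseudo-partition is a tuple $\lambda=(\lambda_1,\dots,\lambda_k)$ of positive integers such that $\lambda_i+1\ge\lambda_{i+1}$ for all $i\in\{1,\dots,k-1\}$. Its diagram is $D(\lambda)=\{(i,j)\in\{1,\dots,k\}\times\{1,2,\dots\}: j\le\lambda_i\}$. A tableau of shape $\lambda$ is a map $T:D(\lambda)\to\{1,2,3,\dots\}$; it is semistandard if $T(i,j_1)\le T(i,j_2)$ whenever $j_1<j_2$ (both cells in $D(\lambda)$) and $T(i_1,j)<T(i_2,j)$ whenever $i_1<i_2$ (both cells in $D(\lambda)$, regardless of whether intermediate cells exist). The surface of $T$ is $(T(1,\lambda_1),\dots,T(k,\lambda_k))$. $\mathrm{SST}(\lambda,s)$ is the set of semistandard tableaux of shape $\lambda$ with surface $s$. For a tableau with entries in $\{1,\dots,n\}$, $\mathrm{wt}(T)=\prod_{(i,j)\in D(\lambda)}x_{T(i,j)}$, with $x_1,\dots,x_n$ commuting indeterminates. $h_m$ is the complete homogeneous symmetric polynomial, with $h_0=1$ and $h_m=0$ for $m<0$. *)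

theory Defs
  imports
    "HOL-Library.Poly_Mapping"
    "HOL-Library.FuncSet"
    "Jordan_Normal_Form.Determinant"
begin

text \<open>
  Tuples are lists, so the \<open>i\<close>-th entry (\<open>i \<ge> 1\<close>) of a tuple \<open>lam\<close> is \<open>lam ! (i - 1)\<close>.
  Cells of diagrams are numbered from 1.
\<close>

definition pseudo_partition :: "nat list \<Rightarrow> bool" where
  "pseudo_partition lam \<longleftrightarrow>
     (\<forall>i<length lam. 0 < lam ! i) \<and>
     (\<forall>i. Suc i < length lam \<longrightarrow> lam ! Suc i \<le> lam ! i + 1)"

definition diagram :: "nat list \<Rightarrow> (nat \<times> nat) set" where
  "diagram lam = {(i, j). i \<in> {1..length lam} \<and> j \<in> {1..lam ! (i - 1)}}"

text \<open>
  Tableaux are extensional functions, so that two tableaux of the same shape are equal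
  iff they agree on the diagram.
\<close>

definition tableaux :: "nat list \<Rightarrow> (nat \<times> nat \<Rightarrow> nat) set" where
  "tableaux lam = diagram lam \<rightarrow>\<^sub>E {1..}"

definition semistandard :: "nat list \<Rightarrow> (nat \<times> nat \<Rightarrow> nat) \<Rightarrow> bool" where
  "semistandard lam T \<longleftrightarrow>
     (\<forall>i j1 j2. (i, j1) \<in> diagram lam \<and> (i, j2) \<in> diagram lam \<and> j1 < j2
        \<longrightarrow> T (i, j1) \<le> T (i, j2)) \<and>
     (\<forall>i1 i2 j. (i1, j) \<in> diagram lam \<and> (i2, j) \<in> diagram lam \<and> i1 < i2
        \<longrightarrow> T (i1, j) < T (i2, j))"

definition surface :: "nat list \<Rightarrow> (nat \<times> nat \<Rightarrow> nat) \<Rightarrow> nat list" where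
  "surface lam T = map (\<lambda>i. T (i, lam ! (i - 1))) [1..<Suc (length lam)]"

definition SST :: "nat list \<Rightarrow> nat list \<Rightarrow> (nat \<times> nat \<Rightarrow> nat) set" where
  "SST lam s = {T \<in> tableaux lam. semistandard lam T \<and> surface lam T = s}"

text \<open>
  Polynomials over \<open>'a\<close> in the indeterminates \<open>x\<^sub>0, x\<^sub>1, x\<^sub>2, \<dots>\<close>: a monomial is a finitely
  supported exponent function, a polynomial a finitely supported coefficient function on
  monomials. The polynomial ring in \<open>x\<^sub>1, \<dots>, x\<^sub>n\<close> is a subring.
\<close>

type_synonym 'a mpoly = "(nat \<Rightarrow>\<^sub>0 nat) \<Rightarrow>\<^sub>0 'a"

definition X :: "nat \<Rightarrow> 'a :: comm_ring_1 mpoly" where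
  "X i = Poly_Mapping.single (Poly_Mapping.single i 1) 1"

definition wt :: "nat list \<Rightarrow> (nat \<times> nat \<Rightarrow> nat) \<Rightarrow> 'a :: comm_ring_1 mpoly" where
  "wt lam T = (\<Prod>c\<in>diagram lam. X (T c))"

text \<open>
  \<open>hom_sym m r\<close> is \<open>h\<^sub>m(x\<^sub>1, \<dots>, x\<^sub>r)\<close>, the sum of \<open>x\<^bsub>i\<^sub>1\<^esub> \<cdots> x\<^bsub>i\<^sub>m\<^esub>\<close> over
  \<open>1 \<le> i\<^sub>1 \<le> \<dots> \<le> i\<^sub>m \<le> r\<close>.
\<close>

definition hom_sym :: "int \<Rightarrow> nat \<Rightarrow> 'a :: comm_ring_1 mpoly" where
  "hom_sym m r =
     (if m < 0 then 0
      else \<Sum>is | length is = nat m \<and> sorted is \<and> set is \<subseteq> {1..r}. prod_list (map X is))"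

text \<open>The index sets of the sums and products above and of the sum over \<open>SST lam s\<close> are finite.\<close>

lemma finite_diagram: "finite (diagram lam)"
proof (rule finite_subset)
  show "diagram lam \<subseteq> Sigma {1..length lam} (\<lambda>i. {1..lam ! (i - 1)})"
    by (auto simp: diagram_def)
qed simp

lemma finite_hom_sym_index:
  "finite {is :: nat list. length is = m \<and> sorted is \<and> set is \<subseteq> {1..r}}"
  by (rule finite_subset[OF _ finite_lists_length_eq[of "{1..r}" m]]) auto

lemma finite_SST: "finite (SST lam s)"
proof (rule finite_subset)
  show "SST lam s \<subseteq> diagram lam \<rightarrow>\<^sub>E {..Max (set s)}"
  proof
    fix T assume T: "T \<in> SST lam s"
    have "T (i, j) \<le> Max (set s)" if c: "(i, j) \<in> diagram lam" for i j
    proof -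
      have i: "i \<in> {1..length lam}" and j: "1 \<le> j" "j \<le> lam ! (i - 1)"
        using c by (auto simp: diagram_def)
      have e: "(i, lam ! (i - 1)) \<in> diagram lam"
        using i j by (auto simp: diagram_def)
      have "T (i, j) \<le> T (i, lam ! (i - 1))"
      proof (cases "j = lam ! (i - 1)")
        case False
        then show ?thesis
          using T c e j unfolding SST_def semistandard_def by auto
      qed simp
      also have "T (i, lam ! (i - 1)) \<in> set (surface lam T)"
        using i unfolding surface_def set_map set_upt by (intro imageI) auto
      then have "T (i, lam ! (i - 1)) \<le> Max (set s)"
        using T by (auto simp: SST_def)
      finally show ?thesis .
    qed
    moreover have "T \<in> extensional (diagram lam)"
      using T by (auto simp: SST_def tableaux_def PiE_def)
    ultimately show "T \<in> diagram lam \<rightarrow>\<^sub>E {..Max (set s)}"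
      by (auto simp: PiE_def)
  qed
  show "finite (diagram lam \<rightarrow>\<^sub>E {..Max (set s)})"
    by (intro finite_PiE finite_diagram) auto
qed

end

theory Submission
  imports Defs
begin

text \<open>
  Induction on the number of cells. If all rows have length 1, the matrix is unitriangular and
  there is exactly one tableau. Otherwise let \<open>j\<close> be the first row of maximal length. In a
  tableau with surface \<open>s\<close>, deleting the last cell of row \<open>j\<close> leaves a tableau of a smaller
  pseudo-partition whose surface has \<open>s\<^sub>j\<close> replaced by some \<open>t\<close> with \<open>s\<^bsub>j-1\<^esub> < t \<le> s\<^sub>j\<close>, and every
  such tableau arises. On the determinant side one expands column \<open>j\<close> by
  \<open>h\<^sub>m(x\<^sub>1, \<dots>, x\<^sub>r) = h\<^sub>m(x\<^sub>1, \<dots>, x\<^sub>q) + \<Sum>\<^bsub>q < t \<le> r\<^esub> x\<^sub>t h\<^bsub>m-1\<^esub>(x\<^sub>1, \<dots>, x\<^sub>t)\<close>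
  with \<open>r = s\<^sub>j\<close> and \<open>q = s\<^bsub>j-1\<^esub>\<close>: by the choice of \<open>j\<close>, the first summand reproduces column
  \<open>j - 1\<close> (or is zero if \<open>j\<close> is the first row), so it contributes nothing.
\<close>

section \<open>Complete homogeneous symmetric polynomials\<close>

lemma hom_sym_neg: "m < 0 \<Longrightarrow> hom_sym m r = 0"
  by (simp add: hom_sym_def)

lemma hom_sym_0: "hom_sym 0 r = 1"
proof -
  have "{is :: nat list. length is = 0 \<and> sorted is \<and> set is \<subseteq> {1..r}} = {[]}"
    by auto
  then show ?thesis
    by (simp add: hom_sym_def)
qed

lemma hom_sym_no_vars:
  assumes "0 < m"
  shows "hom_sym m 0 = 0"
proof -
  have "{is :: nat list. length is = nat m \<and> sorted is \<and> set is \<subseteq> {1..0}} = {}"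
    using assms by auto
  then show ?thesis
    unfolding hom_sym_def by (simp only: sum.empty if_cancel)
qed

text \<open>Sort the weakly increasing words by their last letter: either it is at most
  \<open>r\<close>, or it is \<open>Suc r\<close> and can be stripped off. For
  \<open>m \<le> 0\<close> the identity reads \<open>1 = 1 + 0\<close> or
  \<open>0 = 0\<close>.\<close>

lemma hom_sym_Suc:
  "(hom_sym m (Suc r) :: 'a :: comm_ring_1 mpoly) =
     hom_sym m r + X (Suc r) * hom_sym (m - 1) (Suc r)"
proof (cases "m \<le> 0")
  case True
  then consider "m = 0" | "m < 0"
    by linarith
  then show ?thesis
    by cases (simp_all add: hom_sym_0 hom_sym_neg)
next
  case False
  define d where "d = nat (m - 1)"
  have m: "nat m = Suc d" "nat (m - 1) = d"
    using False by (auto simp: d_def)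
  let ?A = "\<lambda>e r. {is :: nat list. length is = e \<and> sorted is \<and> set is \<subseteq> {1..r}}"
  let ?snoc = "\<lambda>is. is @ [Suc r]"
  have split: "?A (Suc d) (Suc r) = ?A (Suc d) r \<union> ?snoc ` ?A d (Suc r)"
  proof (intro equalityI subsetI)
    fix us assume us: "us \<in> ?A (Suc d) (Suc r)"
    then obtain vs v where v: "us = vs @ [v]"
      by (cases us rule: rev_cases) auto
    show "us \<in> ?A (Suc d) r \<union> ?snoc ` ?A d (Suc r)"
    proof (cases "v = Suc r")
      case True
      then show ?thesis
        using us v by (auto simp: sorted_append)
    next
      case False
      then have "v \<le> r"
        using us v by auto
      moreover have "\<forall>u\<in>set us. u \<le> v"
        using us v by (auto simp: sorted_append)
      ultimately show ?thesis
        using us by fastforce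
    qed
  next
    fix us assume "us \<in> ?A (Suc d) r \<union> ?snoc ` ?A d (Suc r)"
    then show "us \<in> ?A (Suc d) (Suc r)"
      by (fastforce simp: sorted_append)
  qed
  have disj: "?A (Suc d) r \<inter> ?snoc ` ?A d (Suc r) = {}"
    by auto
  have inj: "inj_on ?snoc (?A d (Suc r))"
    by (auto simp: inj_on_def)
  have "(hom_sym m (Suc r) :: 'a mpoly) =
      (\<Sum>us\<in>?A (Suc d) r \<union> ?snoc ` ?A d (Suc r). prod_list (map X us))"
    using False m split by (simp add: hom_sym_def)
  also have "\<dots> = (\<Sum>us\<in>?A (Suc d) r. prod_list (map X us)) +
      (\<Sum>us\<in>?snoc ` ?A d (Suc r). prod_list (map X us))"
    using disj finite_hom_sym_index by (intro sum.union_disjoint finite_imageI) auto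
  also have "(\<Sum>us\<in>?snoc ` ?A d (Suc r). prod_list (map X us) :: 'a mpoly) =
      X (Suc r) * (\<Sum>us\<in>?A d (Suc r). prod_list (map X us))"
    by (subst sum.reindex[OF inj]) (simp add: sum_distrib_left mult.commute)
  finally show ?thesis
    using False m by (simp add: hom_sym_def)
qed

lemma hom_sym_telescope:
  assumes "q \<le> r"
  shows "(hom_sym m r :: 'a :: comm_ring_1 mpoly) =
     hom_sym m q + (\<Sum>t\<in>{q<..r}. X t * hom_sym (m - 1) t)"
  using assms
proof (induction r rule: dec_induct)
  case (step r)
  have "{q<..Suc r} = insert (Suc r) {q<..r}"
    using step by auto
  then show ?case
    by (simp add: hom_sym_Suc[of m r] step.IH algebra_simps)
qed simp

section \<open>Removing a cell\<close>

text \<open>Translates between rows numbered from 1 and list positions numbered from 0: row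
  \<open>Suc i\<close> ends in column \<open>lam ! i\<close>.\<close>

lemma surface_eq_iff:
  "surface lam T = s \<longleftrightarrow>
     length s = length lam \<and> (\<forall>i<length lam. T (Suc i, lam ! i) = s ! i)"
proof -
  have "surface lam T ! i = T (Suc i, lam ! i)" if "i < length lam" for i
    using that by (simp add: surface_def del: upt_Suc)
  moreover have "length (surface lam T) = length lam"
    by (simp add: surface_def del: upt_Suc)
  ultimately show ?thesis
    by (auto simp: list_eq_iff_nth_eq)
qed

text \<open>By \<open>max\<close> and \<open>first\<close>, position \<open>j\<close> holds the
  first row of maximal length \<open>m\<close>. The cell to be removed is
  \<open>(Suc j, m)\<close>.\<close>

context
  fixes lam :: "nat list" and j m :: nat and lam' :: "nat list"
  assumes pp: "pseudo_partition lam"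
    and j: "j < length lam"
    and m: "lam ! j = m" "1 < m"
    and max: "\<And>i. i < length lam \<Longrightarrow> lam ! i \<le> m"
    and first: "\<And>i. i < j \<Longrightarrow> lam ! i < m"
    and lam': "lam' = lam[j := m - 1]"
begin

lemma length_shrunk: "length lam' = length lam"
  by (simp add: lam')

text \<open>The critical pair is row \<open>j\<close> and its successor: by maximality the successor
  has length at most \<open>m = (m - 1) + 1\<close>. Positivity of the shortened row comes from
  \<open>1 < m\<close>.\<close>

lemma pseudo_partition_shrunk: "pseudo_partition lam'"
  unfolding pseudo_partition_def
proof (intro conjI allI impI)
  fix i assume "i < length lam'"
  then show "0 < lam' ! i"
    using pp m by (cases "i = j") (simp_all add: pseudo_partition_def lam')
next
  fix i assume i: "Suc i < length lam'"
  then have "lam ! Suc i \<le> lam ! i + 1"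
    using pp by (simp add: pseudo_partition_def lam')
  moreover have "lam ! Suc i \<le> m"
    using max i by (simp add: lam')
  ultimately show "lam' ! Suc i \<le> lam' ! i + 1"
    using m j i by (auto simp: lam' nth_list_update)
qed

text \<open>The row before \<open>j\<close> is shorter than \<open>m\<close>, but by at most one.
  Hence its last cell stands directly above the left neighbour of the removed cell.\<close>

lemma previous_row_length:
  assumes "0 < j"
  shows "lam ! (j - 1) = m - 1"
proof -
  obtain i where i: "j = Suc i"
    using assms gr0_implies_Suc by blast
  then have "lam ! Suc i \<le> lam ! i + 1"
    using pp j by (simp add: pseudo_partition_def)
  then show ?thesis
    using first[of i] m i by simp
qed

lemma diagram_shrunk: "diagram lam = insert (Suc j, m) (diagram lam')"
  and corner_notin: "(Suc j, m) \<notin> diagram lam'"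
proof -
  have "(a, b) \<in> diagram lam \<longleftrightarrow> (a, b) \<in> insert (Suc j, m) (diagram lam')" for a b
    using j m by (cases a) (auto simp: diagram_def lam' nth_list_update)
  then show "diagram lam = insert (Suc j, m) (diagram lam')"
    by auto
  show "(Suc j, m) \<notin> diagram lam'"
    using j m by (auto simp: diagram_def lam')
qed

text \<open>The left neighbour of the removed cell becomes the new surface cell of its row. Its
  lower bound is the surface entry directly above it, or 0 in the first row since entries are
  positive.\<close>

lemma SST_restrict:
  assumes s: "length s = length lam" "sorted_wrt (<) s"
    and T: "T \<in> SST lam s"
  shows "restrict T (diagram lam') \<in> SST lam' (s[j := T (Suc j, m - 1)])"
    and "(if j = 0 then 0 else s ! (j - 1)) < T (Suc j, m - 1)"
    and "T (Suc j, m - 1) \<le> s ! j"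
    and "T (Suc j, m) = s ! j"
proof -
  have tab: "T \<in> tableaux lam" and ss: "semistandard lam T"
    and sf: "\<And>i. i < length lam \<Longrightarrow> T (Suc i, lam ! i) = s ! i"
    using T by (auto simp: SST_def surface_eq_iff)
  note D = diagram_shrunk
  have c1: "(Suc j, m) \<in> diagram lam" and c2: "(Suc j, m - 1) \<in> diagram lam"
    using j m by (auto simp: diagram_def)
  show corner: "T (Suc j, m) = s ! j"
    using sf[OF j] m by simp
  have "m - 1 < m"
    using m by simp
  then have "T (Suc j, m - 1) \<le> T (Suc j, m)"
    using ss c1 c2 unfolding semistandard_def by blast
  then show "T (Suc j, m - 1) \<le> s ! j"
    using corner by simp
  show "(if j = 0 then 0 else s ! (j - 1)) < T (Suc j, m - 1)"
  proof (cases "j = 0")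
    case True
    then show ?thesis
      using PiE_mem[OF tab[unfolded tableaux_def] c2] by simp
  next
    case False
    then have e: "T (j, m - 1) = s ! (j - 1)"
      using sf[of "j - 1"] j previous_row_length by simp
    have "(j, m - 1) \<in> diagram lam"
      using False j m previous_row_length by (auto simp: diagram_def)
    then have "T (j, m - 1) < T (Suc j, m - 1)"
      using ss c2 unfolding semistandard_def by blast
    then show ?thesis
      using False e by simp
  qed
  have "restrict T (diagram lam') \<in> tableaux lam'"
    using tab D by (auto simp: tableaux_def)
  moreover have "semistandard lam' (restrict T (diagram lam'))"
    using ss D unfolding semistandard_def by simp
  moreover have "restrict T (diagram lam') (Suc i, lam' ! i) = s[j := T (Suc j, m - 1)] ! i"
    if "i < length lam'" for i
  proof -
    \<comment> \<open>Row ends must be cells of the smaller diagram, as \<open>restrict\<close>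
      yields \<open>undefined\<close> elsewhere; this holds because all rows are nonempty.\<close>
    have "(Suc i, lam' ! i) \<in> diagram lam'"
      using that pseudo_partition_shrunk by (auto simp: diagram_def pseudo_partition_def Suc_le_eq)
    then show ?thesis
      using that sf[of i] s by (cases "i = j") (auto simp: lam')
  qed
  ultimately show "restrict T (diagram lam') \<in> SST lam' (s[j := T (Suc j, m - 1)])"
    using s by (simp add: SST_def surface_eq_iff length_shrunk)
qed

lemma SST_extend:
  assumes s: "length s = length lam" "sorted_wrt (<) s"
    and T: "T \<in> SST lam' (s[j := t])" and t: "t \<le> s ! j"
  shows "T((Suc j, m) := s ! j) \<in> SST lam s"
    and "T (Suc j, m - 1) = t"
proof -
  let ?T = "T((Suc j, m) := s ! j)"
  have tab: "T \<in> tableaux lam'" and ss: "semistandard lam' T"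
    and sf: "\<And>i. i < length lam \<Longrightarrow> T (Suc i, lam' ! i) = s[j := t] ! i"
    using T by (auto simp: SST_def surface_eq_iff length_shrunk)
  note D = diagram_shrunk and notin = corner_notin
  have c2: "(Suc j, m - 1) \<in> diagram lam'"
    using j m by (auto simp: diagram_def lam')
  show t_eq: "T (Suc j, m - 1) = t"
    using sf[OF j] j s by (simp add: lam')
  \<comment> \<open>Together with \<open>t \<le> s ! j\<close> this makes the new entry
    \<open>s ! j\<close> positive.\<close>
  have "0 < t"
    using PiE_mem[OF tab[unfolded tableaux_def] c2] t_eq by simp
  then have "?T \<in> tableaux lam"
    using tab t unfolding tableaux_def D PiE_def Pi_def extensional_def by auto
  moreover have "semistandard lam ?T"
    unfolding semistandard_def
  proof (intro conjI allI impI; elim conjE)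
    fix i j1 j2
    assume c: "(i, j1) \<in> diagram lam" "(i, j2) \<in> diagram lam" "j1 < j2"
    show "?T (i, j1) \<le> ?T (i, j2)"
    proof (cases "i = Suc j \<and> j2 = m")
      case True
      then have c1: "(Suc j, j1) \<in> diagram lam'" "j1 \<le> m - 1"
        using c D by auto
      have "T (Suc j, j1) \<le> T (Suc j, m - 1)"
      proof (cases "j1 = m - 1")
        case False
        then have "j1 < m - 1"
          using c1 by simp
        then show ?thesis
          using ss c1 c2 unfolding semistandard_def by blast
      qed simp
      then show ?thesis
        using True c t t_eq by simp
    next
      case False
      then have c': "(i, j2) \<in> diagram lam'"
        using c D by auto
      have "(i, j1) \<noteq> (Suc j, m)"
      proof
        assume "(i, j1) = (Suc j, m)"
        then show False
          using c m by (auto simp: diagram_def)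
      qed
      then show ?thesis
        using False c c' D ss unfolding semistandard_def by auto
    qed
  next
    fix i1 i2 b
    assume c: "(i1, b) \<in> diagram lam" "(i2, b) \<in> diagram lam" "i1 < i2"
    \<comment> \<open>By \<open>first\<close>, no earlier row reaches column \<open>m\<close>, so
      the new cell is never the lower one of a pair.\<close>
    have "(i2, b) \<noteq> (Suc j, m)"
    proof
      assume "(i2, b) = (Suc j, m)"
      then show False
        using c first[of "i1 - 1"] by (cases i1) (auto simp: diagram_def)
    qed
    then have c': "(i2, b) \<in> diagram lam'"
      using c D by auto
    show "?T (i1, b) < ?T (i2, b)"
    proof (cases "(i1, b) = (Suc j, m)")
      case True
      have i2: "i2 - 1 < length lam" "j < i2 - 1" "Suc (i2 - 1) = i2"
        using c True by (auto simp: diagram_def)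
      have "lam ! (i2 - 1) = m"
        using c True max[OF i2(1)] by (auto simp: diagram_def)
      \<comment> \<open>Row \<open>i2\<close> also has maximal length, so its cell in column \<open>m\<close> lies on the surface.\<close>
      then have "T (i2, m) = s ! (i2 - 1)"
        using sf[OF i2(1)] i2 by (simp add: lam')
      moreover have "s ! j < s ! (i2 - 1)"
        using s i2 by (simp add: sorted_wrt_iff_nth_less)
      ultimately show ?thesis
        using True c by auto
    next
      case False
      then show ?thesis
        using \<open>(i2, b) \<noteq> (Suc j, m)\<close> c c' D ss unfolding semistandard_def by auto
    qed
  qed
  moreover have "?T (Suc i, lam ! i) = s ! i" if "i < length lam" for i
    using sf[OF that] m by (auto simp: lam')
  ultimately show "?T \<in> SST lam s"
    using s by (simp add: SST_def surface_eq_iff)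
qed

text \<open>Removing the cell is a bijection onto pairs of \<open>t\<close>, the entry to its left,
  and the remaining tableau; the weight loses the factor \<open>X (s ! j)\<close>.\<close>

lemma sum_SST_remove_corner:
  assumes s: "length s = length lam" "sorted_wrt (<) s"
  shows "(\<Sum>T\<in>SST lam s. wt lam T :: 'a :: comm_ring_1 mpoly) =
     X (s ! j) * (\<Sum>t\<in>{(if j = 0 then 0 else s ! (j - 1))<..s ! j}.
       \<Sum>T\<in>SST lam' (s[j := t]). wt lam' T)"
proof -
  let ?q = "if j = 0 then 0 else s ! (j - 1)"
  have "(\<Sum>T\<in>SST lam s. wt lam T :: 'a mpoly) =
      (\<Sum>(t, T)\<in>Sigma {?q<..s ! j} (\<lambda>t. SST lam' (s[j := t])). X (s ! j) * wt lam' T)"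
  proof (rule sum.reindex_bij_witness[where
      i = "\<lambda>(t, T). T((Suc j, m) := s ! j)" and
      j = "\<lambda>T. (T (Suc j, m - 1), restrict T (diagram lam'))"])
    fix T assume T: "T \<in> SST lam s"
    note r = SST_restrict[OF s T]
    \<comment> \<open>Off the diagram both sides are \<open>undefined\<close>, so the two maps are
      inverse as functions and not only on cells.\<close>
    have "T \<in> extensional (diagram lam)"
      using T by (auto simp: SST_def tableaux_def PiE_def)
    then show "(case (T (Suc j, m - 1), restrict T (diagram lam')) of
        (t, T) \<Rightarrow> T((Suc j, m) := s ! j)) = T"
      using r(4) diagram_shrunk by (auto simp: fun_eq_iff extensional_def)
    show "(T (Suc j, m - 1), restrict T (diagram lam')) \<in>
        Sigma {?q<..s ! j} (\<lambda>t. SST lam' (s[j := t]))"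
      using r by simp
    have "(\<Prod>c\<in>diagram lam'. X (restrict T (diagram lam') c)) =
        (\<Prod>c\<in>diagram lam'. X (T c) :: 'a mpoly)"
      by (rule prod.cong) auto
    then show "(case (T (Suc j, m - 1), restrict T (diagram lam')) of
        (t, T) \<Rightarrow> X (s ! j) * wt lam' T) = (wt lam T :: 'a mpoly)"
      using r(4) corner_notin by (simp add: wt_def diagram_shrunk finite_diagram)
  next
    fix p assume "p \<in> Sigma {?q<..s ! j} (\<lambda>t. SST lam' (s[j := t]))"
    then obtain t T where p: "p = (t, T)" and t: "t \<le> s ! j" and T: "T \<in> SST lam' (s[j := t])"
      by auto
    note r = SST_extend[OF s T t]
    have "T \<in> extensional (diagram lam')"
      using T by (auto simp: SST_def tableaux_def PiE_def)
    then have "restrict (T((Suc j, m) := s ! j)) (diagram lam') = T"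
      using corner_notin by (auto simp: fun_eq_iff extensional_def restrict_def)
    then show "((case p of (t, T) \<Rightarrow> T((Suc j, m) := s ! j)) (Suc j, m - 1),
        restrict (case p of (t, T) \<Rightarrow> T((Suc j, m) := s ! j)) (diagram lam')) = p"
      using p r(2) m by auto
    show "(case p of (t, T) \<Rightarrow> T((Suc j, m) := s ! j)) \<in> SST lam s"
      using p r(1) by simp
  qed
  also have "\<dots> = X (s ! j) * (\<Sum>t\<in>{?q<..s ! j}. \<Sum>T\<in>SST lam' (s[j := t]). wt lam' T)"
    by (simp add: sum.Sigma[symmetric] finite_SST sum_distrib_left)
  finally show ?thesis .
qed

end

section \<open>The determinant\<close>

text \<open>Linearity of the determinant in column \<open>j\<close>, by Laplace expansion along that
  column.\<close>

lemma det_column_sum: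
  fixes g :: "nat \<Rightarrow> 'a :: comm_ring_1" and f :: "'b \<Rightarrow> nat \<Rightarrow> 'a"
  assumes j: "j < k"
  shows "det (mat k k (\<lambda>(i, l). if l = j then g i + (\<Sum>t\<in>S. c t * f t i) else A i l)) =
     det (mat k k (\<lambda>(i, l). if l = j then g i else A i l)) +
     (\<Sum>t\<in>S. c t * det (mat k k (\<lambda>(i, l). if l = j then f t i else A i l)))"
proof -
  let ?M = "\<lambda>u. mat k k (\<lambda>(i, l). if l = j then u i else A i l)"
  \<comment> \<open>Deleting column \<open>j\<close> erases \<open>u\<close>, so all these matrices
    share the cofactors of the one whose column \<open>j\<close> is zero.\<close>
  have minor: "mat_delete (?M u) i j = mat_delete (?M (\<lambda>_. 0)) i j" for u :: "nat \<Rightarrow> 'a" and i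
    using j by (intro eq_matI) (auto simp: mat_delete_def)
  have expand: "det (?M u) = (\<Sum>i<k. u i * cofactor (?M (\<lambda>_. 0)) i j)" for u :: "nat \<Rightarrow> 'a"
  proof -
    have "det (?M u) = (\<Sum>i<k. ?M u $$ (i, j) * cofactor (?M u) i j)"
      using j laplace_expansion_column[of "?M u" k j] by simp
    then show ?thesis
      using j by (simp add: cofactor_def minor[of u])
  qed
  have "(\<Sum>i<k. (\<Sum>t\<in>S. c t * f t i) * C i) = (\<Sum>t\<in>S. c t * (\<Sum>i<k. f t i * C i))"
    for C :: "nat \<Rightarrow> 'a"
    by (simp add: sum_distrib_left sum_distrib_right mult.assoc) (rule sum.swap)
  then show ?thesis
    by (simp add: expand distrib_right sum.distrib)
qed

text \<open>A flagged Jacobi-Trudi matrix: column \<open>j\<close> uses only the first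
  \<open>s ! j\<close> variables. Counting both indices from 0 leaves the degree unchanged, since
  the shifts cancel.\<close>

definition jt_mat :: "nat \<Rightarrow> nat list \<Rightarrow> nat list \<Rightarrow> 'a :: comm_ring_1 mpoly mat" where
  "jt_mat k lam s = mat k k (\<lambda>(i, j). hom_sym (int (lam ! j) - int j + int i - 1) (s ! j))"

lemma det_jt_mat_remove_corner:
  assumes len: "length lam = k" "length s = k" and s: "sorted_wrt (<) s"
    and j: "j < k" and m: "lam ! j = m" "1 < m"
    and prev: "0 < j \<Longrightarrow> lam ! (j - 1) = m - 1"
  shows "(det (jt_mat k lam s) :: 'a :: comm_ring_1 mpoly) =
     (\<Sum>t\<in>{(if j = 0 then 0 else s ! (j - 1))<..s ! j}.
       X t * det (jt_mat k (lam[j := m - 1]) (s[j := t])))"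
proof -
  define q where "q = (if j = 0 then 0 else s ! (j - 1))"
  define A :: "nat \<Rightarrow> nat \<Rightarrow> 'a mpoly" where
    "A i l = hom_sym (int (lam ! l) - int l + int i - 1) (s ! l)" for i l
  define g :: "nat \<Rightarrow> 'a mpoly" where "g i = hom_sym (int m - int j + int i - 1) q" for i
  define f :: "nat \<Rightarrow> nat \<Rightarrow> 'a mpoly" where
    "f t i = hom_sym (int (m - 1) - int j + int i - 1) t" for t i
  have "q \<le> s ! j"
    using s j len by (cases "j = 0") (auto simp: q_def sorted_wrt_iff_nth_less intro: less_imp_le)
  then have "A i j = g i + (\<Sum>t\<in>{q<..s ! j}. X t * f t i)" for i
    using hom_sym_telescope[of q "s ! j" "int m - int j + int i - 1"] m
    by (simp add: A_def g_def f_def of_nat_diff algebra_simps)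
  then have 1: "jt_mat k lam s =
      mat k k (\<lambda>(i, l). if l = j then g i + (\<Sum>t\<in>{q<..s ! j}. X t * f t i) else A i l)"
    unfolding jt_mat_def by (intro eq_matI) (auto simp: A_def)
  have 2: "mat k k (\<lambda>(i, l). if l = j then f t i else A i l) =
      jt_mat k (lam[j := m - 1]) (s[j := t])" for t
    unfolding jt_mat_def using len j by (intro eq_matI) (auto simp: A_def f_def)
  let ?G = "mat k k (\<lambda>(i, l). if l = j then g i else A i l)"
  have 3: "det ?G = 0"
  proof (cases "j = 0")
    case True
    \<comment> \<open>The degree \<open>m + i - 1\<close> is positive and there are no
      variables.\<close>
    then have "g i = 0" for i
      using m by (simp add: g_def q_def hom_sym_no_vars)
    then show ?thesis
      using j laplace_expansion_column[of ?G k j] by simp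
  next
    case False
    \<comment> \<open>The degrees agree since \<open>m - j = (m - 1) - (j - 1)\<close>, and
      \<open>q\<close> is the number of variables in column \<open>j - 1\<close>.\<close>
    have "col ?G j = col ?G (j - 1)"
      using False j m prev by (intro eq_vecI) (auto simp: g_def A_def q_def of_nat_diff)
    then show ?thesis
      using det_identical_columns[of ?G k j "j - 1"] j False by simp
  qed
  show ?thesis
    unfolding q_def[symmetric] 1 det_column_sum[OF j] 2 3 by simp
qed

section \<open>Induction on the number of cells\<close>

lemma sum_wt_SST_eq_det:
  assumes "length lam = k" "pseudo_partition lam" "length s = k" "sorted_wrt (<) s"
    and "0 \<notin> set s"
  shows "(\<Sum>T\<in>SST lam s. wt lam T :: 'a :: comm_ring_1 mpoly) =
     (\<Prod>i<k. X (s ! i)) * det (jt_mat k lam s)"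
  using assms
proof (induction "sum_list lam" arbitrary: lam s rule: less_induct)
  case less
  show ?case
  proof (cases "\<forall>i<k. lam ! i = 1")
    case True
    have D: "diagram lam = (\<lambda>i. (Suc i, 1)) ` {..<k}"
    proof -
      have "(a, b) \<in> diagram lam \<longleftrightarrow> (a, b) \<in> (\<lambda>i. (Suc i, 1)) ` {..<k}" for a b
        using True less.prems by (cases a) (auto simp: diagram_def)
      then show ?thesis
        by auto
    qed
    let ?T = "restrict (\<lambda>(a, b). s ! (a - 1)) (diagram lam)"
    \<comment> \<open>Every cell lies on the surface, so \<open>s\<close> prescribes the whole
      tableau.\<close>
    have "SST lam s = {?T}"
    proof (intro equalityI subsetI)
      fix T assume "T \<in> SST lam s"
      then have "T \<in> extensional (diagram lam)" "\<And>i. i < k \<Longrightarrow> T (Suc i, 1) = s ! i"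
        using less.prems True by (auto simp: SST_def tableaux_def PiE_def surface_eq_iff)
      then have "T = ?T"
        by (intro extensionalityI[of _ "diagram lam"]) (auto simp: D)
      then show "T \<in> {?T}"
        by simp
    next
      fix T assume T: "T \<in> {?T}"
      have "?T \<in> tableaux lam"
      proof -
        have "0 < s ! i" if "i < k" for i
          using that less.prems nth_mem[of i s] by (cases "s ! i = 0") auto
        then show ?thesis
          by (auto simp: tableaux_def D Suc_le_eq)
      qed
      moreover have "semistandard lam ?T"
        using less.prems by (auto simp: semistandard_def D sorted_wrt_iff_nth_less)
      moreover have "surface lam ?T = s"
        using less.prems True by (auto simp: surface_eq_iff D)
      ultimately show "T \<in> SST lam s"
        using T by (simp add: SST_def)
    qed
    then have "(\<Sum>T\<in>SST lam s. wt lam T :: 'a mpoly) = (\<Prod>i<k. X (s ! i))"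
      by (simp add: wt_def) (simp add: D prod.reindex inj_on_def)
    moreover have "det (jt_mat k lam s :: 'a mpoly mat) = 1"
    proof -
      \<comment> \<open>The degree is now \<open>i - j\<close>: negative above the diagonal and zero
        on it.\<close>
      have "det (jt_mat k lam s :: 'a mpoly mat) = prod_list (diag_mat (jt_mat k lam s))"
        using True by (intro det_lower_triangular[of k]) (auto simp: jt_mat_def hom_sym_neg)
      also have "diag_mat (jt_mat k lam s :: 'a mpoly mat) = map (\<lambda>_. 1) [0..<k]"
        using True by (auto simp: diag_mat_def jt_mat_def hom_sym_0)
      finally show ?thesis
        by (simp add: map_replicate_const)
    qed
    ultimately show ?thesis
      by simp
  next
    case False
    define m where "m = Max (set lam)"
    define j where "j = (LEAST i. i < k \<and> lam ! i = m)"
    define lam' where "lam' = lam[j := m - 1]"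
    define q where "q = (if j = 0 then 0 else s ! (j - 1))"
    have max: "lam ! i \<le> m" if "i < length lam" for i
      using that by (simp add: m_def)
    have "set lam \<noteq> {}"
      using False less.prems by auto
    then have "m \<in> set lam"
      by (simp add: m_def)
    then have "\<exists>i. i < k \<and> lam ! i = m"
      using less.prems by (auto simp: in_set_conv_nth)
    from LeastI_ex[OF this] have j: "j < k" and jm: "lam ! j = m"
      by (simp_all add: j_def)
    have first: "lam ! i < m" if "i < j" for i
    proof -
      have "lam ! i \<noteq> m"
        using not_less_Least[of i "\<lambda>i. i < k \<and> lam ! i = m"] that j by (auto simp: j_def)
      then show ?thesis
        using max[of i] that j less.prems by simp
    qed
    have m: "1 < m"
    proof -
      obtain i where i: "i < k" "lam ! i \<noteq> 1"
        using False by auto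
      then have "0 < lam ! i"
        using less.prems by (auto simp: pseudo_partition_def)
      then show ?thesis
        using i max[of i] less.prems by simp
    qed
    have j': "j < length lam"
      using j less.prems by simp
    note cell = less.prems(2) j' jm m max first lam'_def
    have size: "sum_list lam' < sum_list lam"
      using j' jm m elem_le_sum_list[OF j'] by (simp add: lam'_def sum_list_update)
    have IH: "(\<Sum>T\<in>SST lam' (s[j := t]). wt lam' T :: 'a mpoly) =
        (\<Prod>i<k. X (s[j := t] ! i)) * det (jt_mat k lam' (s[j := t]))"
      if t: "t \<in> {q<..s ! j}" for t
    proof (rule less.hyps[OF size])
      show "length lam' = k" "length (s[j := t]) = k"
        using less.prems by (simp_all add: lam'_def)
      show "pseudo_partition lam'"
        using pseudo_partition_shrunk[OF cell] .
      \<comment> \<open>Entries before position \<open>j\<close> are at most \<open>q < t\<close>,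
        and those after it exceed \<open>s ! j \<ge> t\<close>, so the new surface is again strictly
        increasing.\<close>
      have "s ! i < t" if "i < j" for i
      proof -
        have "s ! i \<le> s ! (j - 1)"
          using that j less.prems by (cases "i = j - 1") (auto simp: sorted_wrt_iff_nth_less less_imp_le)
        then show ?thesis
          using t that by (simp add: q_def)
      qed
      moreover have "t < s ! i" if "j < i" "i < k" for i
        using that t less.prems by (fastforce simp: sorted_wrt_iff_nth_less)
      ultimately show "sorted_wrt (<) (s[j := t])"
        unfolding sorted_wrt_iff_nth_less
      proof (intro allI impI)
        fix a b assume below: "\<And>i. i < j \<Longrightarrow> s ! i < t"
          and above: "\<And>i. j < i \<Longrightarrow> i < k \<Longrightarrow> t < s ! i"
          and ab: "a < b" "b < length (s[j := t])"
        have "s ! a < s ! b"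
          using ab less.prems by (simp add: sorted_wrt_iff_nth_less)
        then show "s[j := t] ! a < s[j := t] ! b"
          using ab below[of a] above[of b] less.prems by (cases "a = j"; cases "b = j") auto
      qed
      show "0 \<notin> set (s[j := t])"
        using t less.prems set_update_subset_insert[of s j t] by auto
    qed
    \<comment> \<open>Exchanges the variable of the removed cell for the factor \<open>X t\<close>
      that the column expansion of the determinant supplies.\<close>
    have pr: "X (s ! j) * (\<Prod>i<k. X (s[j := t] ! i)) = (\<Prod>i<k. X (s ! i)) * (X t :: 'a mpoly)" for t
    proof -
      have "(\<Prod>i\<in>{..<k} - {j}. X (s[j := t] ! i)) = (\<Prod>i\<in>{..<k} - {j}. X (s ! i) :: 'a mpoly)"
        by (rule prod.cong) auto
      then show ?thesis
        using j less.prems by (simp add: prod.remove[of "{..<k}" j] ac_simps)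
    qed
    have "(\<Sum>T\<in>SST lam s. wt lam T :: 'a mpoly) =
        X (s ! j) * (\<Sum>t\<in>{q<..s ! j}. \<Sum>T\<in>SST lam' (s[j := t]). wt lam' T)"
      unfolding q_def using less.prems by (intro sum_SST_remove_corner[OF cell]) auto
    also have "\<dots> = (\<Sum>t\<in>{q<..s ! j}.
        (X (s ! j) * (\<Prod>i<k. X (s[j := t] ! i))) * det (jt_mat k lam' (s[j := t])))"
      by (simp add: IH sum_distrib_left mult.assoc)
    also have "\<dots> = (\<Prod>i<k. X (s ! i)) *
        (\<Sum>t\<in>{q<..s ! j}. X t * det (jt_mat k lam' (s[j := t])))"
      by (simp add: pr sum_distrib_left mult.assoc)
    also have "(\<Sum>t\<in>{q<..s ! j}. X t * det (jt_mat k lam' (s[j := t]))) =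
        (det (jt_mat k lam s) :: 'a mpoly)"
      unfolding q_def lam'_def using less.prems j jm m previous_row_length[OF cell]
      by (intro det_jt_mat_remove_corner[symmetric]) auto
    finally show ?thesis .
  qed
qed

theorem theorem5p3:
  fixes lam s :: "nat list" and k n :: nat
  assumes "length lam = k" and "pseudo_partition lam"
    and "length s = k" and "sorted_wrt (<) s" and "set s \<subseteq> {1..n}"
  shows "(\<Sum>T\<in>SST lam s. wt lam T :: 'a :: comm_ring_1 mpoly) =
     (\<Prod>i<k. X (s ! i)) *
     det (mat k k (\<lambda>(i, j). hom_sym (int (lam ! j) - int j + int i - 1) (s ! j)))"
proof -
  have "0 \<notin> set s"
    using assms(5) by auto
  then show ?thesis
    using sum_wt_SST_eq_det[OF assms(1-4)] by (simp add: jt_mat_def)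
qed

end
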